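(* Let $f \in \mathbb{C}[x_1,\ldots,x_n]_d$ be a homogeneous polynomial of degree $d$ and let $\mathcal{A}_f$ be its apolar algebra. Then $$\mathbf{R}(\mathcal{A}_f) \le (3d+1)\,\mathbf{R}_S(f).$$
   Context: Let $\mathcal{R}^n=\mathbb{C}[\partial_1,\ldots,\partial_n]$ act on $\mathbb{C}[x_1,\ldots,x_n]$ by differentiation ($\partial_i$ acts as $\partial/\partial x_i$), written $h\circ f$. $\mathrm{Ann}(f)=\{h\in\mathcal{R}^n : h\circ f=0\}$, and the apolar algebra is $\mathcal{A}_f=\mathcal{R}^n/\mathrm{Ann}(f)$, a finite-dimensional commutative unital $\mathbb{C}$-algebra. For a finite-dimensional algebra $A$ with basis $e_1,\ldots,e_m$, its structure tensor is $\sum_{i,j} e_i\otimes e_j\otimes (e_ie_j)\in A\otimes A\otimes A$, and $\mathbf{R}(A)$ denotes the tensor rank of this tensor (the minimum number of simple tensors $u\otimes v\otimes w$ summing to it). The Waring rank $\mathbf{R}_S(f)$ is the minimum $r$ such that $f=\sum_{i=1}^r c_i\ell_i^d$ for linear forms $\ell_i$ and scalars $c_i$. *)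

theory Defs
  imports
    "HOL-Library.Poly_Mapping"
    "HOL-Library.Extended_Nat"
    "HOL-Algebra.QuotRing"
    "Jordan_Normal_Form.VS_Connect"
begin

section \<open>Polynomials in finitely many variables\<close>

text \<open>
  A monomial is its exponent vector, so \<open>Poly_Mapping.single m c\<close> is the term \<open>c x\<^sup>m\<close>, and
  \<open>Poly_Mapping.single 0 c\<close> is the constant \<open>c\<close>. The number of variables is \<open>n = CARD('n)\<close>.
  The same type serves for the ring acted upon and for the ring of differential operators,
  whose variables are the \<open>\<partial>\<^sub>i\<close>.
\<close>

type_synonym 'n mvpoly = "('n \<Rightarrow>\<^sub>0 nat) \<Rightarrow>\<^sub>0 complex"

definition mv_var :: "'n \<Rightarrow> 'n mvpoly" where
  "mv_var i = Poly_Mapping.single (Poly_Mapping.single i 1) 1"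

definition homogeneous :: "nat \<Rightarrow> 'n::finite mvpoly \<Rightarrow> bool" where
  "homogeneous d f \<longleftrightarrow> (\<forall>m \<in> Poly_Mapping.keys f. (\<Sum>i\<in>UNIV. Poly_Mapping.lookup m i) = d)"

definition waring_rank :: "nat \<Rightarrow> 'n::finite mvpoly \<Rightarrow> enat" where
  "waring_rank d f = Inf {enat r | r. \<exists>(c :: nat \<Rightarrow> complex) (l :: nat \<Rightarrow> 'n mvpoly).
     (\<forall>i<r. homogeneous 1 (l i)) \<and> f = (\<Sum>i<r. Poly_Mapping.single 0 (c i) * l i ^ d)}"


section \<open>The apolar algebra\<close>

text \<open>Where \<open>m\<^sub>i = 0\<close> the truncated exponent is harmless, as the coefficient vanishes.\<close>

definition partial :: "'n \<Rightarrow> 'n mvpoly \<Rightarrow> 'n mvpoly" where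
  "partial i f = (\<Sum>m \<in> Poly_Mapping.keys f.
     Poly_Mapping.single (m - Poly_Mapping.single i 1)
       (of_nat (Poly_Mapping.lookup m i) * Poly_Mapping.lookup f m))"

text \<open>The fold is well defined because partial derivatives commute (see \<open>partial_commute\<close>).\<close>

definition partial_monom :: "('n \<Rightarrow>\<^sub>0 nat) \<Rightarrow> 'n mvpoly \<Rightarrow> 'n mvpoly" where
  "partial_monom a f =
     Finite_Set.fold (\<lambda>i. partial i ^^ Poly_Mapping.lookup a i) f (Poly_Mapping.keys a)"

definition diff_act :: "'n mvpoly \<Rightarrow> 'n mvpoly \<Rightarrow> 'n mvpoly" (infixr \<open>\<circ>\<^sub>\<partial>\<close> 75) where
  "h \<circ>\<^sub>\<partial> f = (\<Sum>a \<in> Poly_Mapping.keys h.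
     Poly_Mapping.single 0 (Poly_Mapping.lookup h a) * partial_monom a f)"

definition Ann :: "'n mvpoly \<Rightarrow> 'n mvpoly set" where
  "Ann f = {h. h \<circ>\<^sub>\<partial> f = 0}"

text \<open>The scalar action on the quotient ring is multiplication by the class of a constant.\<close>

definition apolar_algebra :: "'n mvpoly \<Rightarrow> (complex, 'n mvpoly set) module" where
  "apolar_algebra f = (let Q = class_ring Quot Ann f in
     \<lparr> carrier = carrier Q, mult = mult Q, one = one Q, zero = zero Q, add = add Q,
       smult = (\<lambda>c X. (Ann f +>\<^bsub>class_ring\<^esub> Poly_Mapping.single 0 c) \<otimes>\<^bsub>Q\<^esub> X) \<rparr>)"


section \<open>Tensor rank and the rank of an algebra\<close>

text \<open>
  \<open>V \<otimes> V \<otimes> V\<close> is the free vector space on the triples of vectors modulo the subspace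
  \<open>trilinear_rel V\<close> generated by the trilinearity relations. Tensors are given by
  representatives in the free space, and \<open>s\<close>, \<open>t\<close> represent the same tensor iff
  \<open>s - t \<in> trilinear_rel V\<close>.
\<close>

type_synonym 'v tensor3 = "('v \<times> 'v \<times> 'v) \<Rightarrow>\<^sub>0 complex"

definition simple_tensor :: "'v \<Rightarrow> 'v \<Rightarrow> 'v \<Rightarrow> 'v tensor3" where
  "simple_tensor u v w = Poly_Mapping.single (u, v, w) 1"

definition scale_tensor :: "complex \<Rightarrow> 'v tensor3 \<Rightarrow> 'v tensor3" where
  "scale_tensor c t = Poly_Mapping.map ((*) c) t"

inductive_set trilinear_rel :: "(complex, 'v) module \<Rightarrow> 'v tensor3 set"
  for V :: "(complex, 'v) module" where
  zero: "0 \<in> trilinear_rel V"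
| add: "s \<in> trilinear_rel V \<Longrightarrow> t \<in> trilinear_rel V \<Longrightarrow> s + t \<in> trilinear_rel V"
| scale: "t \<in> trilinear_rel V \<Longrightarrow> scale_tensor c t \<in> trilinear_rel V"
| add1: "\<lbrakk>u \<in> carrier V; u' \<in> carrier V; v \<in> carrier V; w \<in> carrier V\<rbrakk> \<Longrightarrow>
    simple_tensor (u \<oplus>\<^bsub>V\<^esub> u') v w - (simple_tensor u v w + simple_tensor u' v w) \<in> trilinear_rel V"
| add2: "\<lbrakk>u \<in> carrier V; v \<in> carrier V; v' \<in> carrier V; w \<in> carrier V\<rbrakk> \<Longrightarrow>
    simple_tensor u (v \<oplus>\<^bsub>V\<^esub> v') w - (simple_tensor u v w + simple_tensor u v' w) \<in> trilinear_rel V"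
| add3: "\<lbrakk>u \<in> carrier V; v \<in> carrier V; w \<in> carrier V; w' \<in> carrier V\<rbrakk> \<Longrightarrow>
    simple_tensor u v (w \<oplus>\<^bsub>V\<^esub> w') - (simple_tensor u v w + simple_tensor u v w') \<in> trilinear_rel V"
| smult1: "\<lbrakk>u \<in> carrier V; v \<in> carrier V; w \<in> carrier V\<rbrakk> \<Longrightarrow>
    simple_tensor (c \<odot>\<^bsub>V\<^esub> u) v w - scale_tensor c (simple_tensor u v w) \<in> trilinear_rel V"
| smult2: "\<lbrakk>u \<in> carrier V; v \<in> carrier V; w \<in> carrier V\<rbrakk> \<Longrightarrow>
    simple_tensor u (c \<odot>\<^bsub>V\<^esub> v) w - scale_tensor c (simple_tensor u v w) \<in> trilinear_rel V"
| smult3: "\<lbrakk>u \<in> carrier V; v \<in> carrier V; w \<in> carrier V\<rbrakk> \<Longrightarrow>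
    simple_tensor u v (c \<odot>\<^bsub>V\<^esub> w) - scale_tensor c (simple_tensor u v w) \<in> trilinear_rel V"

definition tensor_eq :: "(complex, 'v) module \<Rightarrow> 'v tensor3 \<Rightarrow> 'v tensor3 \<Rightarrow> bool" where
  "tensor_eq V s t \<longleftrightarrow> s - t \<in> trilinear_rel V"

definition tensor_rank :: "(complex, 'v) module \<Rightarrow> 'v tensor3 \<Rightarrow> enat" where
  "tensor_rank V t = Inf {enat r | r. \<exists>u v w :: nat \<Rightarrow> 'v.
     (\<forall>i<r. u i \<in> carrier V \<and> v i \<in> carrier V \<and> w i \<in> carrier V) \<and>
     tensor_eq V t (\<Sum>i<r. simple_tensor (u i) (v i) (w i))}"

definition structure_tensor :: "(complex, 'v) module \<Rightarrow> 'v set \<Rightarrow> 'v tensor3" where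
  "structure_tensor A B = (\<Sum>a\<in>B. \<Sum>b\<in>B. simple_tensor a b (a \<otimes>\<^bsub>A\<^esub> b))"

text \<open>
  The structure tensor depends on the basis, its rank does not: a change of basis acts on
  it by an invertible linear map on the first two tensor factors.
\<close>

definition algebra_rank :: "(complex, 'v) module \<Rightarrow> enat" where
  "algebra_rank A = tensor_rank A
     (structure_tensor A (SOME B. finite B \<and> vectorspace.basis class_ring A B))"


section \<open>The polynomial action and the algebra structure of the quotient\<close>

lemma lookup_partial:
  "Poly_Mapping.lookup (partial i f) m =
     of_nat (Poly_Mapping.lookup m i + 1) * Poly_Mapping.lookup f (m + Poly_Mapping.single i 1)"
proof -
  let ?e = "Poly_Mapping.single i (1::nat)"
  let ?g = "\<lambda>k. of_nat (Poly_Mapping.lookup k i) * Poly_Mapping.lookup f k"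
  have eq: "(?g k when k - ?e = m) = (if k = m + ?e then ?g k else 0)" for k
  proof (cases "Poly_Mapping.lookup k i = 0")
    case True
    then have "k \<noteq> m + ?e" by (auto simp: lookup_add)
    with True show ?thesis by (simp add: when_def)
  next
    case False
    then have "k - ?e + ?e = k"
      by (intro poly_mapping_eqI) (auto simp: lookup_add lookup_minus lookup_single when_def)
    then have "k - ?e = m \<longleftrightarrow> k = m + ?e" by auto
    then show ?thesis by (simp add: when_def)
  qed
  have "Poly_Mapping.lookup (partial i f) m = (\<Sum>k\<in>Poly_Mapping.keys f. ?g k when k - ?e = m)"
    by (simp add: partial_def lookup_sum lookup_single)
  also have "\<dots> = (if m + ?e \<in> Poly_Mapping.keys f then ?g (m + ?e) else 0)"
    by (simp only: eq) (simp add: sum.delta)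
  also have "\<dots> = ?g (m + ?e)" by (simp add: in_keys_iff)
  finally show ?thesis by (simp add: lookup_add)
qed

lemma partial_commute: "partial i (partial j f) = partial j (partial i f)"
  by (cases "i = j")
     (auto intro!: poly_mapping_eqI simp: lookup_partial lookup_add lookup_single add_ac)

lemma lookup_partial_power:
  "Poly_Mapping.lookup ((partial i ^^ k) f) m =
     pochhammer (of_nat (Poly_Mapping.lookup m i + 1)) k *
     Poly_Mapping.lookup f (m + Poly_Mapping.single i k)"
proof (induction k arbitrary: m)
  case (Suc k)
  have "m + Poly_Mapping.single i 1 + Poly_Mapping.single i k = m + Poly_Mapping.single i (Suc k)"
    by (simp add: add.assoc single_add[symmetric])
  then show ?case
    by (simp add: Suc lookup_partial pochhammer_rec lookup_add lookup_single add_ac)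
qed simp

lemma partial_power_commute:
  "(partial i ^^ k) ((partial j ^^ l) f) = (partial j ^^ l) ((partial i ^^ k) f)"
  by (cases "i = j")
     (auto intro!: poly_mapping_eqI simp: lookup_partial_power lookup_add lookup_single add_ac
       simp flip: funpow_add[THEN fun_cong, unfolded o_apply])

lemma lookup_partial_monom:
  "Poly_Mapping.lookup (partial_monom a f) m =
     (\<Prod>i\<in>Poly_Mapping.keys a. pochhammer (of_nat (Poly_Mapping.lookup m i + 1)) (Poly_Mapping.lookup a i)) *
     Poly_Mapping.lookup f (m + a)"
proof -
  interpret comp_fun_commute "\<lambda>i. partial i ^^ Poly_Mapping.lookup a i"
    by standard (auto simp: fun_eq_iff partial_power_commute)
  have "Poly_Mapping.lookup (Finite_Set.fold (\<lambda>i. partial i ^^ Poly_Mapping.lookup a i) f S) m =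
     (\<Prod>i\<in>S. pochhammer (of_nat (Poly_Mapping.lookup m i + 1)) (Poly_Mapping.lookup a i)) *
     Poly_Mapping.lookup f (m + (\<Sum>i\<in>S. Poly_Mapping.single i (Poly_Mapping.lookup a i)))"
    if "finite S" for S using that
  proof (induction S arbitrary: m rule: finite_induct)
    case (insert x S)
    have "(\<Prod>i\<in>S. pochhammer (of_nat (Poly_Mapping.lookup (m + Poly_Mapping.single x (Poly_Mapping.lookup a x)) i + 1)) (Poly_Mapping.lookup a i))
       = (\<Prod>i\<in>S. pochhammer (of_nat (Poly_Mapping.lookup m i + 1)) (Poly_Mapping.lookup a i) :: complex)"
      using insert.hyps by (intro prod.cong) (auto simp: lookup_add lookup_single when_def)
    with insert show ?case
      by (simp add: lookup_partial_power add_ac mult_ac)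
  qed simp
  moreover have "(\<Sum>i\<in>Poly_Mapping.keys a. Poly_Mapping.single i (Poly_Mapping.lookup a i)) = a"
    by (intro poly_mapping_eqI) (auto simp: lookup_sum lookup_single when_def in_keys_iff)
  ultimately show ?thesis
    by (simp add: partial_monom_def)
qed


lemma partial_monom_single: "partial_monom (Poly_Mapping.single i 1) f = partial i f"
  by (rule poly_mapping_eqI) (simp add: lookup_partial_monom lookup_partial)

lemma partial_monom_add: "partial_monom (a + b) f = partial_monom a (partial_monom b f)"
proof (rule poly_mapping_eqI)
  fix m
  let ?S = "Poly_Mapping.keys a \<union> Poly_Mapping.keys b"
  have *: "Poly_Mapping.lookup (partial_monom c g) k =
      (\<Prod>i\<in>?S. pochhammer (of_nat (Poly_Mapping.lookup k i + 1)) (Poly_Mapping.lookup c i)) *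
      Poly_Mapping.lookup g (k + c)" if "Poly_Mapping.keys c \<subseteq> ?S" for c g k
    unfolding lookup_partial_monom using that
    by (intro arg_cong2[of _ _ _ _ "(*)"] prod.mono_neutral_left) (auto simp: in_keys_iff)
  show "Poly_Mapping.lookup (partial_monom (a + b) f) m =
      Poly_Mapping.lookup (partial_monom a (partial_monom b f)) m"
    using Poly_Mapping.keys_add[of a b]
    by (simp add: * pochhammer_product' lookup_add prod.distrib add_ac)
qed

lemma lookup_const_mult:
  "Poly_Mapping.lookup (Poly_Mapping.single 0 c * (f :: 'n mvpoly)) m = c * Poly_Mapping.lookup f m"
proof -
  have "Poly_Mapping.map ((*) c) f = Poly_Mapping.single 0 c * f"
    by (rule mult_map_scale_conv_mult)
  then have "Poly_Mapping.lookup (Poly_Mapping.single 0 c * f) m =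
      Poly_Mapping.lookup (Poly_Mapping.map ((*) c) f) m" by simp
  also have "\<dots> = c * Poly_Mapping.lookup f m" by (simp add: Poly_Mapping.map.rep_eq when_def)
  finally show ?thesis .
qed

lemma partial_monom_plus: "partial_monom a (f + g) = partial_monom a f + partial_monom a g"
  by (rule poly_mapping_eqI) (simp add: lookup_partial_monom lookup_add algebra_simps)

lemma partial_monom_const_mult:
  "partial_monom a (Poly_Mapping.single 0 c * f) = Poly_Mapping.single 0 c * partial_monom a f"
  by (rule poly_mapping_eqI) (simp add: lookup_partial_monom lookup_const_mult)

lemma diff_act_superset:
  assumes "finite S" "Poly_Mapping.keys h \<subseteq> S"
  shows "h \<circ>\<^sub>\<partial> f =
    (\<Sum>a\<in>S. Poly_Mapping.single 0 (Poly_Mapping.lookup h a) * partial_monom a f)"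
  unfolding diff_act_def using assms
  by (intro sum.mono_neutral_left) (auto simp: in_keys_iff)

lemma diff_act_single:
  "Poly_Mapping.single a c \<circ>\<^sub>\<partial> f = Poly_Mapping.single 0 c * partial_monom a f"
  by (subst diff_act_superset[of "{a}"]) auto

lemma diff_act_zero_left: "0 \<circ>\<^sub>\<partial> f = 0"
  by (simp add: diff_act_def)

lemma diff_act_add_left: "(h + k) \<circ>\<^sub>\<partial> f = h \<circ>\<^sub>\<partial> f + k \<circ>\<^sub>\<partial> f"
proof -
  let ?S = "Poly_Mapping.keys h \<union> Poly_Mapping.keys k"
  have "g \<circ>\<^sub>\<partial> f = (\<Sum>a\<in>?S. Poly_Mapping.single 0 (Poly_Mapping.lookup g a) * partial_monom a f)"
    if "Poly_Mapping.keys g \<subseteq> ?S" for g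
    using that by (intro diff_act_superset) auto
  then show ?thesis
    using Poly_Mapping.keys_add[of h k]
    by (simp add: lookup_add single_add algebra_simps sum.distrib)
qed

lemma diff_act_add_right: "h \<circ>\<^sub>\<partial> (f + g) = h \<circ>\<^sub>\<partial> f + h \<circ>\<^sub>\<partial> g"
  by (simp add: diff_act_def partial_monom_plus algebra_simps sum.distrib)

lemma diff_act_const_mult_right:
  "h \<circ>\<^sub>\<partial> (Poly_Mapping.single 0 c * f) = Poly_Mapping.single 0 c * (h \<circ>\<^sub>\<partial> f)"
  unfolding diff_act_def partial_monom_const_mult sum_distrib_left by (simp only: mult.left_commute)

lemma mvpoly_induct:
  fixes h :: "'n mvpoly"
  assumes "P 0" and "\<And>a c h. P h \<Longrightarrow> P (Poly_Mapping.single a c + h)"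
  shows "P h"
proof -
  have "P (\<Sum>a\<in>S. Poly_Mapping.single a (Poly_Mapping.lookup h a))" if "finite S" for S
    using that by induction (auto intro: assms)
  moreover have "(\<Sum>a\<in>Poly_Mapping.keys h. Poly_Mapping.single a (Poly_Mapping.lookup h a)) = h"
    by (intro poly_mapping_eqI) (auto simp: lookup_sum lookup_single when_def in_keys_iff)
  ultimately show ?thesis by (metis finite_keys)
qed

lemma diff_act_var: "mv_var i \<circ>\<^sub>\<partial> f = partial i f"
  unfolding mv_var_def diff_act_single partial_monom_single by simp

lemma diff_act_one: "1 \<circ>\<^sub>\<partial> f = f"
  using diff_act_single[of 0 1 f] by (simp add: partial_monom_def)

lemma diff_act_mult: "(h * k) \<circ>\<^sub>\<partial> f = h \<circ>\<^sub>\<partial> (k \<circ>\<^sub>\<partial> f)"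
proof (induction h rule: mvpoly_induct)
  case (2 a c h)
  have "(Poly_Mapping.single a c * k) \<circ>\<^sub>\<partial> f = Poly_Mapping.single a c \<circ>\<^sub>\<partial> (k \<circ>\<^sub>\<partial> f)"
  proof (induction k rule: mvpoly_induct)
    case 1
    show ?case using diff_act_const_mult_right[of _ 0] by (simp add: diff_act_zero_left)
  next
    case (2 b e k)
    then show ?case
      by (simp add: distrib_left diff_act_add_left diff_act_add_right mult_single diff_act_single
        partial_monom_add partial_monom_const_mult partial_monom_plus)
         (simp add: mult.assoc[symmetric] mult_single)
  qed
  with 2 show ?case by (simp add: distrib_right diff_act_add_left)
qed (simp add: diff_act_zero_left)

lemma Ann_ideal: "ideal (Ann f) class_ring"
proof (rule idealI)
  show "ring (class_ring :: 'a mvpoly ring)" by (rule class_ring.ring_axioms)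
  have zero: "h \<circ>\<^sub>\<partial> 0 = 0" for h :: "'a mvpoly"
    using diff_act_const_mult_right[of h 0 0] by simp
  show "subgroup (Ann f) (add_monoid class_ring)"
  proof (rule group.subgroupI)
    show "Group.group (add_monoid (class_ring :: 'a mvpoly ring))"
      by (rule abelian_group.a_group) (rule ring.is_abelian_group, rule class_ring.ring_axioms)
    fix h assume "h \<in> Ann f"
    then have "(- 1 * h) \<circ>\<^sub>\<partial> f = 0" unfolding Ann_def diff_act_mult by (simp add: zero)
    then have "- h \<in> Ann f" by (simp add: Ann_def)
    moreover have "inv\<^bsub>add_monoid class_ring\<^esub> h = - h"
      unfolding a_inv_def[symmetric] by (simp add: class_ring_simps)
    ultimately show "inv\<^bsub>add_monoid class_ring\<^esub> h \<in> Ann f" by simp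
  qed (use diff_act_zero_left[of f] in \<open>auto simp: Ann_def diff_act_add_left\<close>)
  show "x \<otimes>\<^bsub>class_ring\<^esub> a \<in> Ann f" "a \<otimes>\<^bsub>class_ring\<^esub> x \<in> Ann f"
    if "a \<in> Ann f" "x \<in> carrier class_ring" for a x
    using that by (auto simp: Ann_def diff_act_mult zero mult.commute[of a x])
qed

lemma apolar_algebra_is_algebra: "algebra class_ring (apolar_algebra f)"
proof -
  interpret I: ideal "Ann f" class_ring by (rule Ann_ideal)
  let ?Q = "class_ring Quot Ann f"
  interpret Q: cring ?Q by (rule I.quotient_is_cring) (rule class_cring.cring_axioms)
  interpret h: ring_hom_ring class_ring ?Q "(+>\<^bsub>class_ring\<^esub>) (Ann f)"
    by (rule I.rcos_ring_hom_ring)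
  let ?k = "\<lambda>c. Ann f +>\<^bsub>class_ring\<^esub> Poly_Mapping.single 0 c"
  have k: "?k c \<in> carrier ?Q" "?k (c + e) = ?k c \<oplus>\<^bsub>?Q\<^esub> ?k e" "?k (c * e) = ?k c \<otimes>\<^bsub>?Q\<^esub> ?k e"
    "Ann f +>\<^bsub>class_ring\<^esub> 1 = \<one>\<^bsub>?Q\<^esub>" for c e
    using h.hom_closed h.hom_add[of "Poly_Mapping.single 0 c" "Poly_Mapping.single 0 e"]
      h.hom_mult[of "Poly_Mapping.single 0 c" "Poly_Mapping.single 0 e"] h.hom_one
    by (simp_all add: single_add mult_single)
  show ?thesis
  proof (rule algebraI)
    show "cring (class_ring :: complex ring)" by (rule class_cring.cring_axioms)
    show "cring (apolar_algebra f)"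
    proof (intro cringI abelian_groupI comm_monoidI)
      fix X assume "X \<in> carrier (apolar_algebra f)"
      then have "\<ominus>\<^bsub>?Q\<^esub> X \<in> carrier ?Q" "\<ominus>\<^bsub>?Q\<^esub> X \<oplus>\<^bsub>?Q\<^esub> X = \<zero>\<^bsub>?Q\<^esub>"
        by (simp_all add: apolar_algebra_def Let_def Q.l_neg)
      then show "\<exists>Y\<in>carrier (apolar_algebra f). Y \<oplus>\<^bsub>apolar_algebra f\<^esub> X = \<zero>\<^bsub>apolar_algebra f\<^esub>"
        by (auto simp: apolar_algebra_def Let_def)
    qed ((simp add: apolar_algebra_def Let_def Q.m_assoc Q.a_assoc Q.l_distr; fail) |
          (simp add: apolar_algebra_def Let_def Q.m_comm Q.a_comm; fail))+
  qed (simp_all add: apolar_algebra_def Let_def k Q.m_assoc Q.l_distr Q.r_distr)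
qed

end

theory Submission
  imports Defs
begin

text \<open>
  Write \<open>f = \<Sum>\<^sub>i c\<^sub>i l\<^sub>i\<^sup>d\<close> with \<open>r\<close> summands, and let \<open>p\<^sub>i\<close> be the coefficient vector of \<open>l\<^sub>i\<close>.
  A homogeneous operator \<open>h\<close> of degree \<open>k\<close> sends \<open>l\<^sub>i\<^sup>d\<close> to \<open>d!/(d-k)! h(p\<^sub>i) l\<^sub>i\<^bsup>d-k\<^esup>\<close>, so for
  arbitrary \<open>h\<close> of degree below \<open>N\<close> the polynomial \<open>h \<circ> f\<close> depends only on the coefficients of the
  univariate polynomials \<open>h(t p\<^sub>i)\<close>, which a discrete Fourier transform recovers from the values
  \<open>h(\<omega>\<^sup>j p\<^sub>i)\<close> at the \<open>N\<close>-th roots of unity. Classes in the apolar algebra have representatives of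
  degree at most \<open>d\<close>, so for \<open>N > 2d\<close> this applies to the product \<open>gh\<close> of two representatives.
  Since \<open>(gh)(\<omega>\<^sup>j p\<^sub>i) = g(\<omega>\<^sup>j p\<^sub>i) h(\<omega>\<^sup>j p\<^sub>i)\<close>, and since \<open>h \<mapsto> h \<circ> f\<close> is linear with kernel
  \<open>Ann f\<close> and therefore has a linear right inverse on its image, the multiplication of the apolar
  algebra is a sum of \<open>N r\<close> products of two linear forms with a fixed vector.
\<close>

section \<open>Tensors\<close>

lemma lookup_scale_tensor:
  "Poly_Mapping.lookup (scale_tensor c t) k = c * Poly_Mapping.lookup t k"
  by (simp add: scale_tensor_def Poly_Mapping.map.rep_eq when_def)

lemma scale_tensor_0 [simp]: "scale_tensor 0 t = 0" "scale_tensor c 0 = 0"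
  by (auto intro!: poly_mapping_eqI simp: lookup_scale_tensor)

lemma scale_tensor_diff: "scale_tensor c (s - t) = scale_tensor c s - scale_tensor c t"
  by (rule poly_mapping_eqI) (simp add: lookup_scale_tensor lookup_minus algebra_simps)

lemma scale_tensor_sum: "scale_tensor c (sum g S) = (\<Sum>x\<in>S. scale_tensor c (g x))"
  by (rule poly_mapping_eqI) (simp add: lookup_scale_tensor lookup_sum sum_distrib_left)

lemma scale_tensor_scale_tensor: "scale_tensor c (scale_tensor e t) = scale_tensor (c * e) t"
  by (rule poly_mapping_eqI) (simp add: lookup_scale_tensor)

lemma tensor_eq_refl: "tensor_eq V t t"
  by (simp add: tensor_eq_def trilinear_rel.zero)

lemma tensor_eq_sym: "tensor_eq V s t \<Longrightarrow> tensor_eq V t s"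
proof -
  assume "tensor_eq V s t"
  then have "scale_tensor (- 1) (s - t) \<in> trilinear_rel V"
    unfolding tensor_eq_def by (rule trilinear_rel.scale)
  moreover have "scale_tensor (- 1) (s - t) = t - s"
    by (rule poly_mapping_eqI) (simp add: lookup_scale_tensor lookup_minus)
  ultimately show ?thesis by (simp add: tensor_eq_def)
qed

lemma tensor_eq_trans: "tensor_eq V s t \<Longrightarrow> tensor_eq V t u \<Longrightarrow> tensor_eq V s u"
  unfolding tensor_eq_def using trilinear_rel.add[of "s - t" V "t - u"] by simp

lemma tensor_eq_add: "tensor_eq V s t \<Longrightarrow> tensor_eq V s' t' \<Longrightarrow> tensor_eq V (s + s') (t + t')"
  unfolding tensor_eq_def using trilinear_rel.add[of "s - t" V "s' - t'"]
  by (simp add: algebra_simps)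

lemma tensor_eq_scale: "tensor_eq V s t \<Longrightarrow> tensor_eq V (scale_tensor c s) (scale_tensor c t)"
  unfolding tensor_eq_def scale_tensor_diff[symmetric] by (rule trilinear_rel.scale)

lemma tensor_eq_sum:
  assumes "\<And>x. x \<in> S \<Longrightarrow> tensor_eq V (g x) (h x)"
  shows "tensor_eq V (sum g S) (sum h S)"
  using assms
  by (induction S rule: infinite_finite_induct) (auto intro: tensor_eq_add tensor_eq_refl)

text \<open>\<open>F\<close> stands for a simple tensor with one slot left free. Such a map is
  linear only modulo \<open>trilinear_rel V\<close>, so linearity is phrased with
  \<open>tensor_eq\<close>, and one induction serves all three slots.\<close>

lemma tensor_eq_linear_combination:
  fixes V :: "(complex, 'v) module" and x :: "'a \<Rightarrow> 'v"
  assumes V: "module class_ring V" and "finite S" and x: "\<And>a. a \<in> S \<Longrightarrow> x a \<in> carrier V"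
    and add: "\<And>u u'. u \<in> carrier V \<Longrightarrow> u' \<in> carrier V \<Longrightarrow>
      tensor_eq V (F (u \<oplus>\<^bsub>V\<^esub> u')) (F u + F u')"
    and smult: "\<And>c u. u \<in> carrier V \<Longrightarrow> tensor_eq V (F (c \<odot>\<^bsub>V\<^esub> u)) (scale_tensor c (F u))"
  shows "tensor_eq V (F (\<Oplus>\<^bsub>V\<^esub>a\<in>S. c a \<odot>\<^bsub>V\<^esub> x a)) (\<Sum>a\<in>S. scale_tensor (c a) (F (x a)))"
proof -
  interpret V: module class_ring V by (rule V)
  have closed: "e \<odot>\<^bsub>V\<^esub> u \<in> carrier V" if "u \<in> carrier V" for e u
    using V.smult_closed[of e u] that by simp
  from \<open>finite S\<close> x show ?thesis
  proof (induction S rule: finite_induct)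
    case empty
    \<comment> \<open>Writing the zero vector as a multiple with scalar 0 turns homogeneity into the
      vanishing of \<open>F\<close> at zero, up to \<open>tensor_eq\<close>.\<close>
    have "0 \<odot>\<^bsub>V\<^esub> \<zero>\<^bsub>V\<^esub> = \<zero>\<^bsub>V\<^esub>" using V.smult_r_null[of 0] by simp
    then show ?case using smult[of "\<zero>\<^bsub>V\<^esub>" 0] by simp
  next
    case (insert a S)
    have "tensor_eq V (F (c a \<odot>\<^bsub>V\<^esub> x a \<oplus>\<^bsub>V\<^esub> (\<Oplus>\<^bsub>V\<^esub>a\<in>S. c a \<odot>\<^bsub>V\<^esub> x a)))
        (F (c a \<odot>\<^bsub>V\<^esub> x a) + F (\<Oplus>\<^bsub>V\<^esub>a\<in>S. c a \<odot>\<^bsub>V\<^esub> x a))"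
      using insert.prems by (intro add closed V.finsum_closed) (auto simp: closed)
    moreover have "tensor_eq V (F (c a \<odot>\<^bsub>V\<^esub> x a) + F (\<Oplus>\<^bsub>V\<^esub>a\<in>S. c a \<odot>\<^bsub>V\<^esub> x a))
        (scale_tensor (c a) (F (x a)) + (\<Sum>a\<in>S. scale_tensor (c a) (F (x a))))"
      using insert by (intro tensor_eq_add smult) auto
    moreover have "(\<Oplus>\<^bsub>V\<^esub>a\<in>insert a S. c a \<odot>\<^bsub>V\<^esub> x a) =
        c a \<odot>\<^bsub>V\<^esub> x a \<oplus>\<^bsub>V\<^esub> (\<Oplus>\<^bsub>V\<^esub>a\<in>S. c a \<odot>\<^bsub>V\<^esub> x a)"
      using insert by (intro V.finsum_insert) (auto simp: closed)
    ultimately show ?case using insert.hyps by (auto intro: tensor_eq_trans)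
  qed
qed

lemma tensor_rank_le_card:
  assumes "finite I" and "\<And>i. i \<in> I \<Longrightarrow> u i \<in> carrier V \<and> v i \<in> carrier V \<and> w i \<in> carrier V"
    and "tensor_eq V t (\<Sum>i\<in>I. simple_tensor (u i) (v i) (w i))"
  shows "tensor_rank V t \<le> enat (card I)"
proof -
  obtain e where e: "bij_betw e {..<card I} I"
    using ex_bij_betw_nat_finite[OF \<open>finite I\<close>] by (auto simp: atLeast0LessThan)
  have "(\<Sum>i\<in>I. simple_tensor (u i) (v i) (w i)) =
      (\<Sum>k<card I. simple_tensor (u (e k)) (v (e k)) (w (e k)))"
    by (rule sum.reindex_bij_betw[OF e, symmetric])
  with assms e show ?thesis unfolding tensor_rank_def
    by (intro Inf_lower CollectI exI[of _ "card I"] conjI refl exI[of _ "u \<circ> e"]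
        exI[of _ "v \<circ> e"] exI[of _ "w \<circ> e"]) (auto simp: bij_betw_def)
qed

text \<open>Expand the third slot, move the sum over \<open>t\<close> outside, and collect the sums
  over \<open>a\<close> and \<open>b\<close> into the first two slots by bilinearity. Each
  \<open>t\<close> then contributes a single simple tensor.\<close>

lemma structure_tensor_rank_le:
  fixes V :: "(complex, 'v) module"
  assumes V: "module class_ring V" and B: "finite B" "B \<subseteq> carrier V"
    and I: "finite I" "\<And>t. t \<in> I \<Longrightarrow> w t \<in> carrier V"
    and mult: "\<And>a b. a \<in> B \<Longrightarrow> b \<in> B \<Longrightarrow>
      a \<otimes>\<^bsub>V\<^esub> b = (\<Oplus>\<^bsub>V\<^esub>t\<in>I. (\<alpha> t a * \<beta> t b) \<odot>\<^bsub>V\<^esub> w t)"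
  shows "tensor_rank V (structure_tensor V B) \<le> enat (card I)"
proof -
  interpret V: module class_ring V by (rule V)
  have closed: "e \<odot>\<^bsub>V\<^esub> u \<in> carrier V" if "u \<in> carrier V" for e u
    using V.smult_closed[of e u] that by simp
  \<comment> \<open>The structure tensor carries basis vectors where the multiplication map would
    have dual ones, so a linear form with values \<open>\<gamma>\<close> on \<open>B\<close> enters
    as the vector with coefficients \<open>\<gamma>\<close>.\<close>
  define U where "U \<gamma> = (\<Oplus>\<^bsub>V\<^esub>a\<in>B. \<gamma> a \<odot>\<^bsub>V\<^esub> a)" for \<gamma> :: "'v \<Rightarrow> complex"
  have U: "U \<gamma> \<in> carrier V" for \<gamma>
    unfolding U_def using B by (intro V.finsum_closed) (auto simp: closed)
  have "tensor_eq V (structure_tensor V B)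
      (\<Sum>a\<in>B. \<Sum>b\<in>B. \<Sum>t\<in>I. scale_tensor (\<alpha> t a * \<beta> t b) (simple_tensor a b (w t)))"
    unfolding structure_tensor_def
  proof (intro tensor_eq_sum)
    fix a b assume ab: "a \<in> B" "b \<in> B"
    show "tensor_eq V (simple_tensor a b (a \<otimes>\<^bsub>V\<^esub> b))
        (\<Sum>t\<in>I. scale_tensor (\<alpha> t a * \<beta> t b) (simple_tensor a b (w t)))"
      unfolding mult[OF ab] using B I ab
      by (intro tensor_eq_linear_combination[OF V])
        (auto simp: tensor_eq_def intro!: trilinear_rel.add3 trilinear_rel.smult3)
  qed
  also have "(\<Sum>a\<in>B. \<Sum>b\<in>B. \<Sum>t\<in>I. scale_tensor (\<alpha> t a * \<beta> t b) (simple_tensor a b (w t))) =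
      (\<Sum>a\<in>B. \<Sum>t\<in>I. \<Sum>b\<in>B. scale_tensor (\<alpha> t a * \<beta> t b) (simple_tensor a b (w t)))"
    by (intro sum.cong refl sum.swap)
  also have "\<dots> = (\<Sum>t\<in>I. \<Sum>a\<in>B. \<Sum>b\<in>B. scale_tensor (\<alpha> t a * \<beta> t b) (simple_tensor a b (w t)))"
    by (rule sum.swap)
  finally have 1: "tensor_eq V (structure_tensor V B)
      (\<Sum>t\<in>I. \<Sum>a\<in>B. \<Sum>b\<in>B. scale_tensor (\<alpha> t a * \<beta> t b) (simple_tensor a b (w t)))" .
  have 2: "tensor_eq V (simple_tensor (U (\<alpha> t)) (U (\<beta> t)) (w t))
      (\<Sum>a\<in>B. \<Sum>b\<in>B. scale_tensor (\<alpha> t a * \<beta> t b) (simple_tensor a b (w t)))" if t: "t \<in> I" for t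
  proof (rule tensor_eq_trans)
    show "tensor_eq V (simple_tensor (U (\<alpha> t)) (U (\<beta> t)) (w t))
        (\<Sum>a\<in>B. scale_tensor (\<alpha> t a) (simple_tensor a (U (\<beta> t)) (w t)))"
      unfolding U_def[of "\<alpha> t"] using B I t U
      by (intro tensor_eq_linear_combination[OF V])
        (auto simp: tensor_eq_def intro!: trilinear_rel.add1 trilinear_rel.smult1)
    have "tensor_eq V (simple_tensor a (U (\<beta> t)) (w t))
        (\<Sum>b\<in>B. scale_tensor (\<beta> t b) (simple_tensor a b (w t)))" if a: "a \<in> B" for a
      unfolding U_def[of "\<beta> t"] using B I t a
      by (intro tensor_eq_linear_combination[OF V])
        (auto simp: tensor_eq_def intro!: trilinear_rel.add2 trilinear_rel.smult2)
    then show "tensor_eq V (\<Sum>a\<in>B. scale_tensor (\<alpha> t a) (simple_tensor a (U (\<beta> t)) (w t)))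
        (\<Sum>a\<in>B. \<Sum>b\<in>B. scale_tensor (\<alpha> t a * \<beta> t b) (simple_tensor a b (w t)))"
      unfolding scale_tensor_scale_tensor[symmetric] scale_tensor_sum[symmetric]
      by (intro tensor_eq_sum tensor_eq_scale)
  qed
  have "tensor_eq V (structure_tensor V B)
      (\<Sum>t\<in>I. simple_tensor (U (\<alpha> t)) (U (\<beta> t)) (w t))"
    using 1 by (rule tensor_eq_trans) (intro tensor_eq_sum tensor_eq_sym[OF 2])
  then show ?thesis
    using U I by (intro tensor_rank_le_card) auto
qed

section \<open>Degree and evaluation\<close>

definition monom_degree :: "('n::finite \<Rightarrow>\<^sub>0 nat) \<Rightarrow> nat" where
  "monom_degree m = (\<Sum>i\<in>UNIV. Poly_Mapping.lookup m i)"

lemma monom_degree_add: "monom_degree (a + b) = monom_degree a + monom_degree b"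
  by (simp add: monom_degree_def lookup_add sum.distrib)

lemma monom_degree_single [simp]: "monom_degree (Poly_Mapping.single i k) = k"
  by (simp add: monom_degree_def lookup_single when_def)

lemma monom_degree_eq_0_iff: "monom_degree m = 0 \<longleftrightarrow> m = 0"
  by (auto simp: monom_degree_def intro: poly_mapping_eqI)

lemma finite_monom_degree_le: "finite {m :: 'n::finite \<Rightarrow>\<^sub>0 nat. monom_degree m \<le> d}"
proof (rule finite_imageD)
  show "inj_on Poly_Mapping.lookup {m :: 'n \<Rightarrow>\<^sub>0 nat. monom_degree m \<le> d}"
    by (simp add: inj_on_def lookup_inject)
  have "Poly_Mapping.lookup m i \<le> d" if "monom_degree m \<le> d" for m :: "'n \<Rightarrow>\<^sub>0 nat" and i
    using that member_le_sum[of i UNIV "Poly_Mapping.lookup m"] by (simp add: monom_degree_def)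
  then have "Poly_Mapping.lookup ` {m :: 'n \<Rightarrow>\<^sub>0 nat. monom_degree m \<le> d} \<subseteq> PiE UNIV (\<lambda>_. {..d})"
    by auto
  then show "finite (Poly_Mapping.lookup ` {m :: 'n \<Rightarrow>\<^sub>0 nat. monom_degree m \<le> d})"
    by (rule finite_subset) (simp add: finite_PiE)
qed

definition monom_eval :: "('n::finite \<Rightarrow> complex) \<Rightarrow> ('n \<Rightarrow>\<^sub>0 nat) \<Rightarrow> complex" where
  "monom_eval p m = (\<Prod>i\<in>UNIV. p i ^ Poly_Mapping.lookup m i)"

lemma monom_eval_add: "monom_eval p (a + b) = monom_eval p a * monom_eval p b"
  by (simp add: monom_eval_def lookup_add power_add prod.distrib)

lemma monom_eval_single_1 [simp]: "monom_eval p (Poly_Mapping.single i 1) = p i"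
proof -
  have "monom_eval p (Poly_Mapping.single i 1) = (\<Prod>j\<in>UNIV. if j = i then p j else 1)"
    unfolding monom_eval_def by (intro prod.cong) (auto simp: lookup_single when_def)
  then show ?thesis by simp
qed

lemma monom_eval_0 [simp]: "monom_eval p 0 = 1"
  by (simp add: monom_eval_def)

text \<open>Along the line through \<open>p\<close> the degree of a monomial becomes an exponent of
  \<open>z\<close>; this lets values at roots of unity separate the homogeneous parts of an
  operator.\<close>

lemma monom_eval_scale: "monom_eval (\<lambda>i. z * p i) m = z ^ monom_degree m * monom_eval p m"
  by (simp add: monom_eval_def monom_degree_def power_mult_distrib prod.distrib power_sum)

definition mv_eval :: "('n::finite \<Rightarrow> complex) \<Rightarrow> 'n mvpoly \<Rightarrow> complex" where
  "mv_eval p h = (\<Sum>m\<in>Poly_Mapping.keys h. Poly_Mapping.lookup h m * monom_eval p m)"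

lemma mv_eval_superset:
  assumes "finite S" "Poly_Mapping.keys h \<subseteq> S"
  shows "mv_eval p h = (\<Sum>m\<in>S. Poly_Mapping.lookup h m * monom_eval p m)"
  unfolding mv_eval_def using assms by (intro sum.mono_neutral_left) (auto simp: in_keys_iff)

lemma mv_eval_0 [simp]: "mv_eval p 0 = 0"
  by (simp add: mv_eval_def)

lemma mv_eval_add: "mv_eval p (g + h) = mv_eval p g + mv_eval p h"
proof -
  let ?S = "Poly_Mapping.keys g \<union> Poly_Mapping.keys h"
  have "mv_eval p k = (\<Sum>m\<in>?S. Poly_Mapping.lookup k m * monom_eval p m)"
    if "Poly_Mapping.keys k \<subseteq> ?S" for k
    using that by (intro mv_eval_superset) auto
  then show ?thesis
    using Poly_Mapping.keys_add[of g h] by (simp add: lookup_add algebra_simps sum.distrib)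
qed

lemma mv_eval_single: "mv_eval p (Poly_Mapping.single a c) = c * monom_eval p a"
  by (subst mv_eval_superset[of "{a}"]) auto

text \<open>This is what later splits each coefficient belonging to a product of two operators into
  one factor per operator.\<close>

lemma mv_eval_mult: "mv_eval p (g * h) = mv_eval p g * mv_eval p h"
proof (induction g rule: mvpoly_induct)
  case (2 a c g)
  have "mv_eval p (Poly_Mapping.single a c * h) = mv_eval p (Poly_Mapping.single a c) * mv_eval p h"
    by (induction h rule: mvpoly_induct)
      (simp_all add: mv_eval_add mv_eval_single mult_single monom_eval_add algebra_simps)
  with 2 show ?case by (simp add: mv_eval_add distrib_right)
qed simp

lemma keys_mult_degree_le:
  assumes "\<And>m. m \<in> Poly_Mapping.keys g \<Longrightarrow> monom_degree m \<le> d"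
    and "\<And>m. m \<in> Poly_Mapping.keys h \<Longrightarrow> monom_degree m \<le> e"
    and "m \<in> Poly_Mapping.keys (g * h :: 'n::finite mvpoly)"
  shows "monom_degree m \<le> d + e"
  using assms keys_mult[of g h] by (fastforce simp: monom_degree_add intro: add_mono)

section \<open>Derivatives of powers of linear forms\<close>

lemma partial_add: "partial i (f + g) = partial i f + partial i g"
  by (rule poly_mapping_eqI) (simp add: lookup_partial lookup_add algebra_simps)

lemma partial_0 [simp]: "partial i 0 = 0"
  by (simp add: partial_def)

lemma partial_single:
  "partial i (Poly_Mapping.single m c) =
     Poly_Mapping.single (m - Poly_Mapping.single i 1) (of_nat (Poly_Mapping.lookup m i) * c)"
  by (cases "c = 0") (simp_all add: partial_def)

lemma partial_const_mult:
  "partial i (Poly_Mapping.single 0 c * f) = Poly_Mapping.single 0 c * partial i f"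
  by (rule poly_mapping_eqI) (simp add: lookup_partial lookup_const_mult)

lemma partial_mult_single:
  fixes m k :: "'n::finite \<Rightarrow>\<^sub>0 nat"
  shows "partial i (Poly_Mapping.single m c * Poly_Mapping.single k e) =
    partial i (Poly_Mapping.single m c) * Poly_Mapping.single k e +
    Poly_Mapping.single m c * partial i (Poly_Mapping.single k e)"
proof -
  let ?e = "Poly_Mapping.single i (1::nat)"
  \<comment> \<open>Exponents are subtracted with truncation, so the shift needs a positive exponent
    of the \<open>i\<close>-th variable; when that exponent is 0, the coefficient of the
    differentiated monomial vanishes instead.\<close>
  have shift: "a + b - ?e = a - ?e + b" if "Poly_Mapping.lookup a i \<noteq> 0" for a b :: "'n \<Rightarrow>\<^sub>0 nat"
    using that by (intro poly_mapping_eqI) (auto simp: lookup_add lookup_minus lookup_single when_def)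
  have left: "partial i (Poly_Mapping.single m c) * Poly_Mapping.single k e =
      Poly_Mapping.single (m + k - ?e) (of_nat (Poly_Mapping.lookup m i) * (c * e))"
    by (cases "Poly_Mapping.lookup m i = 0") (simp_all add: partial_single mult_single shift[symmetric] mult.assoc del: One_nat_def)
  have right: "Poly_Mapping.single m c * partial i (Poly_Mapping.single k e) =
      Poly_Mapping.single (m + k - ?e) (of_nat (Poly_Mapping.lookup k i) * (c * e))"
    using shift[of k m]
    by (cases "Poly_Mapping.lookup k i = 0")
      (simp_all add: partial_single mult_single add.commute mult.left_commute del: One_nat_def)
  show ?thesis
    unfolding left right by (simp add: mult_single partial_single lookup_add algebra_simps single_add)
qed

lemma partial_mult:
  fixes f g :: "'n::finite mvpoly"
  shows "partial i (f * g) = partial i f * g + f * partial i g"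
proof (induction f rule: mvpoly_induct)
  case (2 a c f)
  have "partial i (Poly_Mapping.single a c * g) =
      partial i (Poly_Mapping.single a c) * g + Poly_Mapping.single a c * partial i g"
    by (induction g rule: mvpoly_induct)
      (simp_all add: partial_add distrib_left partial_mult_single algebra_simps)
  with 2 show ?case by (simp add: distrib_right partial_add algebra_simps)
qed simp

lemma partial_power:
  fixes l :: "'n::finite mvpoly"
  assumes "partial i l = Poly_Mapping.single 0 c"
  shows "partial i (l ^ k) = Poly_Mapping.single 0 (of_nat k * c) * l ^ (k - 1)"
proof (induction k)
  case 0
  have "partial i (Poly_Mapping.single 0 1 :: 'n mvpoly) = 0" by (simp only: partial_single) simp
  then show ?case by simp
next
  case (Suc k)
  have "l * (Poly_Mapping.single 0 (of_nat k * c) * l ^ (k - 1)) =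
      Poly_Mapping.single 0 (of_nat k * c) * l ^ k"
    by (cases k) (simp_all add: mult_ac)
  then show ?case
    by (simp add: partial_mult Suc assms algebra_simps single_add)
qed

text \<open>Adding one variable to \<open>m\<close> gives degree 1 only for \<open>m = 0\<close>, so
  every other coefficient vanishes. The gradient of a linear form is thus its coefficient vector,
  the direction in which operators will be evaluated.\<close>

lemma partial_homogeneous_1:
  assumes "homogeneous 1 l"
  shows "partial i l = Poly_Mapping.single 0 (Poly_Mapping.lookup l (Poly_Mapping.single i 1))"
proof (rule poly_mapping_eqI)
  fix m
  have "Poly_Mapping.lookup l (m + Poly_Mapping.single i 1) = 0" if "m \<noteq> 0"
  proof -
    have "monom_degree (m + Poly_Mapping.single i 1) \<noteq> 1"
      using that by (simp add: monom_degree_add monom_degree_eq_0_iff)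
    then show ?thesis
      using assms unfolding homogeneous_def monom_degree_def by (metis in_keys_iff)
  qed
  then show "Poly_Mapping.lookup (partial i l) m =
      Poly_Mapping.lookup (Poly_Mapping.single 0 (Poly_Mapping.lookup l (Poly_Mapping.single i 1))) m"
    by (cases "m = 0") (simp_all add: lookup_partial lookup_single)
qed

text \<open>The truncated subtraction makes the product vanish for \<open>k > d\<close>, so that
  \<open>partial_monom_power\<close> needs no case distinction.\<close>

definition falling :: "nat \<Rightarrow> nat \<Rightarrow> complex" where
  "falling d k = (\<Prod>j<k. of_nat (d - j))"

lemma falling_eq_0: "d < k \<Longrightarrow> falling d k = 0"
  by (auto simp: falling_def intro!: bexI[of _ d])

lemma single_0_mult_single_0:
  "Poly_Mapping.single 0 a * (Poly_Mapping.single 0 b * h) =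
    Poly_Mapping.single 0 (a * b) * (h :: 'n mvpoly)"
  by (simp add: mult.assoc[symmetric] mult_single)

text \<open>Induction on the order of the operator: one further derivative brings down the current
  exponent of \<open>l\<close>, which is the next factor of \<open>falling\<close>, and the constant
  \<open>p i\<close>, which is the next factor of \<open>monom_eval\<close>.\<close>

lemma partial_monom_power:
  fixes l :: "'n::finite mvpoly"
  assumes "\<And>i. partial i l = Poly_Mapping.single 0 (p i)"
  shows "partial_monom a (l ^ d) =
    Poly_Mapping.single 0 (falling d (monom_degree a) * monom_eval p a) * l ^ (d - monom_degree a)"
proof (induction "monom_degree a" arbitrary: a)
  case 0
  then have "a = 0" by (simp add: monom_degree_eq_0_iff)
  then show ?case by (simp add: partial_monom_def falling_def monom_degree_def)
next
  case (Suc k)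
  then have "a \<noteq> 0" by (metis monom_degree_eq_0_iff nat.distinct(1))
  then obtain i where i: "Poly_Mapping.lookup a i \<noteq> 0"
    by (metis poly_mapping_eqI lookup_zero)
  let ?e = "Poly_Mapping.single i (1::nat)"
  define b where "b = a - ?e"
  have a: "a = ?e + b"
    using i by (intro poly_mapping_eqI) (auto simp: b_def lookup_add lookup_minus lookup_single when_def)
  have k: "k = monom_degree b" using Suc.hyps(2) by (simp add: a monom_degree_add)
  show ?case
    unfolding a partial_monom_add partial_monom_single Suc.hyps(1)[OF k]
    unfolding partial_const_mult partial_power[OF assms] single_0_mult_single_0
    by (simp add: monom_degree_add monom_eval_add falling_def mult_ac
        monom_eval_single_1[unfolded One_nat_def])
qed

section \<open>Discrete Fourier inversion at roots of unity\<close>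

lemma root_of_unity_orthogonality:
  assumes "k < N" "m < N"
  defines "\<omega> \<equiv> cis (2 * pi / real N)"
  shows "(\<Sum>j<N. \<omega> ^ (j * m) * inverse \<omega> ^ (j * k)) = (if m = k then of_nat N else 0)"
proof -
  have N: "N > 0" using assms by simp
  have w0: "\<omega> \<noteq> 0" by (simp add: \<omega>_def)
  have wN: "\<omega> ^ N = 1" using N by (simp add: \<omega>_def DeMoivre)
  \<comment> \<open>The sum is geometric with ratio \<open>z\<close>, an \<open>N\<close>-th root of
    unity that equals 1 exactly when \<open>m = k\<close>.\<close>
  define z where "z = \<omega> ^ m * inverse \<omega> ^ k"
  have sum: "(\<Sum>j<N. \<omega> ^ (j * m) * inverse \<omega> ^ (j * k)) = (\<Sum>j<N. z ^ j)"
    by (simp add: z_def power_mult_distrib mult.commute flip: power_mult)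
  show ?thesis
  proof (cases "m = k")
    case True
    then have "z = 1" using w0 by (simp add: z_def power_inverse)
    then show ?thesis using True sum by simp
  next
    case False
    \<comment> \<open>Both exponents lie below \<open>N\<close>, where the powers of the primitive
      root \<open>\<omega>\<close> are pairwise distinct.\<close>
    have "inj_on (\<lambda>k. cis (2 * pi * real k / real N)) {..<N}"
      using bij_betw_roots_unity[OF N] by (simp add: bij_betw_def)
    then have "\<omega> ^ m \<noteq> \<omega> ^ k"
      using False assms(1,2) by (auto simp: \<omega>_def DeMoivre inj_on_def mult_ac)
    then have "z \<noteq> 1" using w0 by (auto simp: z_def power_inverse field_simps)
    moreover have "z ^ N = 1"
    proof -
      have "z ^ N = (\<omega> ^ N) ^ m * inverse (\<omega> ^ N) ^ k"
        by (simp add: z_def power_mult_distrib power_inverse mult.commute flip: power_mult)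
      then show ?thesis by (simp add: wN)
    qed
    ultimately show ?thesis using False sum by (simp add: geometric_sum)
  qed
qed

lemma single_0_sum: "Poly_Mapping.single 0 (sum g S) = (\<Sum>x\<in>S. Poly_Mapping.single 0 (g x))"
  by (induction S rule: infinite_finite_induct) (simp_all add: single_add)

text \<open>By linearity in \<open>h\<close> a monomial operator suffices. In \<open>q j\<close>,
  the factor \<open>inverse \<omega> ^ (j * k) / of_nat N\<close> is the inverse Fourier kernel
  extracting the part of degree \<open>k\<close>, and \<open>falling d k\<close> with
  \<open>l ^ (d - k)\<close> is what that part produces from \<open>l ^ d\<close>. As
  \<open>q j\<close> is independent of \<open>h\<close>, only the values of \<open>h\<close> at
  \<open>N\<close> points enter.\<close>

lemma diff_act_power_eq_sum_eval:
  fixes l :: "'n::finite mvpoly"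
  assumes l: "\<And>i. partial i l = Poly_Mapping.single 0 (p i)" and "d < N"
    and h: "\<And>m. m \<in> Poly_Mapping.keys h \<Longrightarrow> monom_degree m < N"
  defines "\<omega> \<equiv> cis (2 * pi / real N)"
  defines "q \<equiv> \<lambda>j. \<Sum>k\<le>d. Poly_Mapping.single 0 (falling d k * inverse \<omega> ^ (j * k) / of_nat N) * l ^ (d - k)"
  shows "h \<circ>\<^sub>\<partial> (l ^ d) = (\<Sum>j<N. Poly_Mapping.single 0 (mv_eval (\<lambda>i. \<omega> ^ j * p i) h) * q j)"
proof -
  have N: "N > 0" using \<open>d < N\<close> by simp
  have monom: "(\<Sum>j<N. Poly_Mapping.single 0 (monom_eval (\<lambda>i. \<omega> ^ j * p i) a) * q j) =
      partial_monom a (l ^ d)" if a: "monom_degree a < N" for a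
  proof -
    let ?m = "monom_degree a"
    have orthogonality: "(\<Sum>j<N. \<omega> ^ (j * ?m) * inverse \<omega> ^ (j * k)) =
        (if ?m = k then of_nat N else 0)" if "k \<le> d" for k
      unfolding \<omega>_def using that \<open>d < N\<close> a by (intro root_of_unity_orthogonality) auto
    have "(\<Sum>j<N. Poly_Mapping.single 0 (monom_eval (\<lambda>i. \<omega> ^ j * p i) a) * q j) =
        (\<Sum>j<N. \<Sum>k\<le>d. Poly_Mapping.single 0 (falling d k * monom_eval p a / of_nat N *
            (\<omega> ^ (j * ?m) * inverse \<omega> ^ (j * k))) * l ^ (d - k))"
      unfolding q_def sum_distrib_left single_0_mult_single_0 monom_eval_scale
      by (simp add: mult_ac flip: power_mult)
    also have "\<dots> = (\<Sum>k\<le>d. \<Sum>j<N. Poly_Mapping.single 0 (falling d k * monom_eval p a / of_nat N *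
            (\<omega> ^ (j * ?m) * inverse \<omega> ^ (j * k))) * l ^ (d - k))"
      by (rule sum.swap)
    also have "\<dots> = (\<Sum>k\<le>d. Poly_Mapping.single 0 (falling d k * monom_eval p a / of_nat N *
            (\<Sum>j<N. \<omega> ^ (j * ?m) * inverse \<omega> ^ (j * k))) * l ^ (d - k))"
      by (simp only: sum_distrib_left single_0_sum sum_distrib_right)
    also have "\<dots> = (\<Sum>k\<le>d. if k = ?m then Poly_Mapping.single 0 (falling d k * monom_eval p a) * l ^ (d - k) else 0)"
      using N by (intro sum.cong) (auto simp: orthogonality)
    \<comment> \<open>If \<open>?m > d\<close>, no index \<open>k\<close> matches and the sum is 0;
      the right-hand side is then 0 as well, because \<open>falling d ?m\<close> is.\<close>
    also have "\<dots> = Poly_Mapping.single 0 (falling d ?m * monom_eval p a) * l ^ (d - ?m)"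
      by (auto simp: falling_eq_0)
    also have "\<dots> = partial_monom a (l ^ d)" by (rule partial_monom_power[OF l, symmetric])
    finally show ?thesis .
  qed
  have "h \<circ>\<^sub>\<partial> (l ^ d) = (\<Sum>a\<in>Poly_Mapping.keys h. Poly_Mapping.single 0 (Poly_Mapping.lookup h a) *
      (\<Sum>j<N. Poly_Mapping.single 0 (monom_eval (\<lambda>i. \<omega> ^ j * p i) a) * q j))"
    unfolding diff_act_def by (intro sum.cong) (simp_all add: monom h)
  also have "\<dots> = (\<Sum>j<N. \<Sum>a\<in>Poly_Mapping.keys h.
      Poly_Mapping.single 0 (Poly_Mapping.lookup h a * monom_eval (\<lambda>i. \<omega> ^ j * p i) a) * q j)"
    unfolding sum_distrib_left single_0_mult_single_0 by (rule sum.swap)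
  also have "\<dots> = (\<Sum>j<N. Poly_Mapping.single 0 (mv_eval (\<lambda>i. \<omega> ^ j * p i) h) * q j)"
    by (simp add: mv_eval_def single_0_sum sum_distrib_right)
  finally show ?thesis .
qed

section \<open>Multiplication in the apolar algebra\<close>

definition apolar_class :: "'n mvpoly \<Rightarrow> 'n mvpoly \<Rightarrow> 'n mvpoly set" where
  "apolar_class f h = Ann f +>\<^bsub>class_ring\<^esub> h"

lemma apolar_class_closed: "apolar_class f h \<in> carrier (apolar_algebra f)"
  and apolar_class_0: "apolar_class f 0 = \<zero>\<^bsub>apolar_algebra f\<^esub>"
  and apolar_class_add:
    "apolar_class f (g + h) = apolar_class f g \<oplus>\<^bsub>apolar_algebra f\<^esub> apolar_class f h"
  and apolar_class_mult:
    "apolar_class f (g * h) = apolar_class f g \<otimes>\<^bsub>apolar_algebra f\<^esub> apolar_class f h"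
  and apolar_class_const_mult:
    "apolar_class f (Poly_Mapping.single 0 c * h) = c \<odot>\<^bsub>apolar_algebra f\<^esub> apolar_class f h"
proof -
  interpret I: ideal "Ann f" class_ring by (rule Ann_ideal)
  interpret h: ring_hom_ring class_ring "class_ring Quot Ann f" "(+>\<^bsub>class_ring\<^esub>) (Ann f)"
    by (rule I.rcos_ring_hom_ring)
  show "apolar_class f h \<in> carrier (apolar_algebra f)" "apolar_class f 0 = \<zero>\<^bsub>apolar_algebra f\<^esub>"
    "apolar_class f (g + h) = apolar_class f g \<oplus>\<^bsub>apolar_algebra f\<^esub> apolar_class f h"
    "apolar_class f (g * h) = apolar_class f g \<otimes>\<^bsub>apolar_algebra f\<^esub> apolar_class f h"
    "apolar_class f (Poly_Mapping.single 0 c * h) = c \<odot>\<^bsub>apolar_algebra f\<^esub> apolar_class f h"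
    using h.hom_closed[of h] h.hom_zero h.hom_add[of g h] h.hom_mult[of g h]
      h.hom_mult[of "Poly_Mapping.single 0 c" h]
    by (simp_all add: apolar_class_def apolar_algebra_def Let_def)
qed

lemma apolar_class_eqI:
  assumes "g \<circ>\<^sub>\<partial> f = h \<circ>\<^sub>\<partial> f"
  shows "apolar_class f g = apolar_class f h"
proof -
  interpret I: ideal "Ann f" class_ring by (rule Ann_ideal)
  have "(g - h) \<circ>\<^sub>\<partial> f = 0"
    using diff_act_add_left[of "g - h" h f] assms by simp
  then have "g \<in> Ann f +>\<^bsub>class_ring\<^esub> h"
    unfolding a_r_coset_def' by (auto simp: Ann_def intro!: bexI[of _ "g - h"])
  then show ?thesis
    unfolding apolar_class_def using I.a_subgroup
    by (intro abelian_group.a_repr_independence[symmetric] ring.is_abelian_group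
        class_ring.ring_axioms) simp_all
qed

lemma carrier_apolar_algebraE:
  assumes "X \<in> carrier (apolar_algebra f)"
  obtains h where "X = apolar_class f h"
  using assms
  by (auto simp: apolar_algebra_def Let_def apolar_class_def FactRing_def A_RCOSETS_def')

lemma apolar_class_sum:
  assumes "finite S"
  shows "apolar_class f (sum g S) = (\<Oplus>\<^bsub>apolar_algebra f\<^esub>x\<in>S. apolar_class f (g x))"
proof -
  interpret A: algebra class_ring "apolar_algebra f" by (rule apolar_algebra_is_algebra)
  show ?thesis using assms
    by (induction S rule: finite_induct)
      (auto simp: apolar_class_0 apolar_class_add apolar_class_closed A.finsum_insert)
qed

section \<open>Truncation at degree \<open>d\<close> and finite dimension\<close>

lemma diff_act_single_eq_0:
  assumes "homogeneous d f" "d < monom_degree a"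
  shows "Poly_Mapping.single a c \<circ>\<^sub>\<partial> f = 0"
proof -
  \<comment> \<open>The coefficient of the derivative at \<open>m\<close> is a multiple of the
    coefficient of \<open>f\<close> at \<open>m + a\<close>, whose degree exceeds
    \<open>d\<close>.\<close>
  have "Poly_Mapping.lookup f (m + a) = 0" for m
  proof -
    have "monom_degree (m + a) \<noteq> d" using assms(2) by (simp add: monom_degree_add)
    then show ?thesis
      using assms(1) unfolding homogeneous_def monom_degree_def by (metis in_keys_iff)
  qed
  then have "partial_monom a f = 0"
    by (intro poly_mapping_eqI) (simp add: lookup_partial_monom)
  then show ?thesis by (simp add: diff_act_single)
qed

lemma apolar_class_low_degree_representative:
  assumes "homogeneous d f"
  obtains g where "apolar_class f g = apolar_class f h"
    and "\<And>m. m \<in> Poly_Mapping.keys g \<Longrightarrow> monom_degree m \<le> d"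
proof -
  have "\<exists>g. g \<circ>\<^sub>\<partial> f = h \<circ>\<^sub>\<partial> f \<and> (\<forall>m\<in>Poly_Mapping.keys g. monom_degree m \<le> d)"
  proof (induction h rule: mvpoly_induct)
    case 1
    show ?case by (intro exI[of _ 0]) simp
  next
    case (2 a c h)
    then obtain g where g: "g \<circ>\<^sub>\<partial> f = h \<circ>\<^sub>\<partial> f" "\<forall>m\<in>Poly_Mapping.keys g. monom_degree m \<le> d"
      by blast
    show ?case
    proof (cases "monom_degree a \<le> d")
      case True
      have "monom_degree m \<le> d" if "m \<in> Poly_Mapping.keys (Poly_Mapping.single a c + g)" for m
        using that True g(2) Poly_Mapping.keys_add[of "Poly_Mapping.single a c" g]
        by (auto split: if_splits)
      then show ?thesis
        using g by (intro exI[of _ "Poly_Mapping.single a c + g"]) (auto simp: diff_act_add_left)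
    next
      case False
      then show ?thesis
        using g diff_act_single_eq_0[OF assms, of a c]
        by (intro exI[of _ g]) (auto simp: diff_act_add_left)
    qed
  qed
  then show thesis using that apolar_class_eqI by metis
qed

lemma apolar_algebra_vectorspace: "vectorspace class_ring (apolar_algebra f)"
proof -
  interpret A: algebra class_ring "apolar_algebra f" by (rule apolar_algebra_is_algebra)
  show ?thesis
    by (intro vectorspace.intro class_field.field_axioms A.module_axioms)
qed

text \<open>The classes of the finitely many monomials of degree at most \<open>d\<close> span,
  since those of higher degree vanish. The existence of a finite basis gives the choice in
  \<open>algebra_rank\<close> its meaning.\<close>

lemma apolar_algebra_finite_basis:
  fixes f :: "'n::finite mvpoly"
  assumes f: "homogeneous d f"
  shows "\<exists>B. finite B \<and> vectorspace.basis class_ring (apolar_algebra f) B"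
proof -
  interpret A: vectorspace class_ring "apolar_algebra f" by (rule apolar_algebra_vectorspace)
  define S where "S = (\<lambda>m. apolar_class f (Poly_Mapping.single m 1)) ` {m. monom_degree m \<le> d}"
  have S: "finite S" "S \<subseteq> carrier (apolar_algebra f)"
    by (auto simp: S_def finite_monom_degree_le apolar_class_closed)
  interpret sub: submodule class_ring "A.span S" "apolar_algebra f"
    using S by (intro A.span_is_submodule)
  have single: "apolar_class f (Poly_Mapping.single a c) \<in> A.span S" for a c
  proof (cases "monom_degree a \<le> d")
    case True
    then have "apolar_class f (Poly_Mapping.single a 1) \<in> A.span S"
      using A.in_own_span[OF S(2)] by (auto simp: S_def)
    moreover have "Poly_Mapping.single a c = Poly_Mapping.single 0 c * Poly_Mapping.single a 1"
      by (simp add: mult_single)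
    ultimately show ?thesis
      using sub.smult_closed[of c] by (simp add: apolar_class_const_mult)
  next
    case False
    then have "apolar_class f (Poly_Mapping.single a c) = apolar_class f 0"
      using f by (intro apolar_class_eqI) (simp add: diff_act_single_eq_0 diff_act_zero_left)
    then show ?thesis using sub.zero_closed by (simp add: apolar_class_0)
  qed
  have "apolar_class f h \<in> A.span S" for h
  proof (induction h rule: mvpoly_induct)
    case 1
    show ?case using sub.zero_closed by (simp add: apolar_class_0)
  next
    case (2 a c h)
    then show ?case using single[of a c] sub.m_closed by (simp add: apolar_class_add)
  qed
  then have "A.span S = carrier (apolar_algebra f)"
    using A.span_is_subset2[OF S(2)] by (auto elim: carrier_apolar_algebraE)
  with S have A.fin_dim unfolding A.fin_dim_def by blast
  then show ?thesis by (rule A.finite_basis_exists)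
qed

section \<open>From a Waring decomposition to a decomposition of the multiplication\<close>

text \<open>Each pair of a summand \<open>i < r\<close> and a root index \<open>j < N\<close> yields
  one simple tensor.\<close>

lemma apolar_algebra_rank_le:
  fixes f :: "'n::finite mvpoly" and l :: "nat \<Rightarrow> 'n mvpoly"
  assumes f: "homogeneous d f" and l: "\<And>i. i < r \<Longrightarrow> homogeneous 1 (l i)"
    and sum: "f = (\<Sum>i<r. Poly_Mapping.single 0 (c i) * l i ^ d)"
    and N: "2 * d < N"
  shows "algebra_rank (apolar_algebra f) \<le> enat (N * r)"
proof -
  let ?A = "apolar_algebra f"
  interpret A: vectorspace class_ring ?A by (rule apolar_algebra_vectorspace)
  \<comment> \<open>This repeats the choice made in \<open>algebra_rank\<close>, so the bound
    concerns the very basis used there.\<close>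
  define B where "B = (SOME B. finite B \<and> A.basis B)"
  have "finite B \<and> A.basis B"
    unfolding B_def by (rule someI_ex) (rule apolar_algebra_finite_basis[OF f])
  then have B: "finite B" "B \<subseteq> carrier ?A" by (auto simp: A.basis_def)

  \<comment> \<open>The linear forms will be prescribed by their values on \<open>B\<close>, so
    representatives are chosen for basis elements only.\<close>
  have "\<exists>g. apolar_class f g = X \<and> (\<forall>m\<in>Poly_Mapping.keys g. monom_degree m \<le> d)"
    if "X \<in> B" for X
    using that B apolar_class_low_degree_representative[OF f] by (metis carrier_apolar_algebraE subsetD)
  then obtain s where s: "\<And>X. X \<in> B \<Longrightarrow> apolar_class f (s X) = X"
    "\<And>X m. X \<in> B \<Longrightarrow> m \<in> Poly_Mapping.keys (s X) \<Longrightarrow> monom_degree m \<le> d"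
    by metis

  let ?scale = "\<lambda>c (h :: 'n mvpoly). Poly_Mapping.single 0 c * h"
  interpret vs: vector_space ?scale
    by unfold_locales (simp_all add: algebra_simps single_add mult.assoc[symmetric] mult_single)
  interpret vsp: vector_space_pair ?scale ?scale ..
  have "Vector_Spaces.linear ?scale ?scale (\<lambda>h. h \<circ>\<^sub>\<partial> f)"
    by unfold_locales
      (simp_all add: diff_act_add_left diff_act_mult diff_act_single partial_monom_def)
  \<comment> \<open>A single \<open>q i j\<close> need not lie in the image of the action on
    \<open>f\<close>. Since \<open>g\<close> is linear on all polynomials it can still be applied to
    each of them, while the right-inverse property is invoked only for
    \<open>h \<circ>\<^sub>\<partial> f\<close>, which does lie in the image.\<close>
  from vsp.linear_exists_right_inverse_on[OF this vs.subspace_UNIV]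
  obtain g where g: "Vector_Spaces.linear ?scale ?scale g" and
    inv: "\<And>h. g (h \<circ>\<^sub>\<partial> f) \<circ>\<^sub>\<partial> f = h \<circ>\<^sub>\<partial> f"
    by auto
  interpret g: Vector_Spaces.linear ?scale ?scale g by (rule g)

  define p where "p i j = Poly_Mapping.lookup (l i) (Poly_Mapping.single j 1)" for i j
  define \<omega> where "\<omega> = cis (2 * pi / real N)"
  define q where "q i j = (\<Sum>k\<le>d. Poly_Mapping.single 0
    (falling d k * inverse \<omega> ^ (j * k) / of_nat N) * l i ^ (d - k))" for i j
  define w where "w = (\<lambda>(i, j). apolar_class f (g (Poly_Mapping.single 0 (c i) * q i j)))"
  \<comment> \<open>Both factors of a product are evaluated at the same point, so this family serves
    as \<open>\<alpha>\<close> and as \<open>\<beta>\<close> in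
    \<open>structure_tensor_rank_le\<close>.\<close>
  define \<alpha> where "\<alpha> = (\<lambda>(i, j) X. mv_eval (\<lambda>k. \<omega> ^ j * p i k) (s X))"
  let ?I = "{..<r} \<times> {..<N}"

  have "X \<otimes>\<^bsub>?A\<^esub> Y = (\<Oplus>\<^bsub>?A\<^esub>t\<in>?I. (\<alpha> t X * \<alpha> t Y) \<odot>\<^bsub>?A\<^esub> w t)" if XY: "X \<in> B" "Y \<in> B" for X Y
  proof -
    define h where "h = s X * s Y"
    have deg: "monom_degree m < N" if "m \<in> Poly_Mapping.keys h" for m
      using keys_mult_degree_le[OF s(2)[OF XY(1)] s(2)[OF XY(2)] that[unfolded h_def]] N by simp
    have act: "h \<circ>\<^sub>\<partial> (l i ^ d) =
        (\<Sum>j<N. Poly_Mapping.single 0 (\<alpha> (i, j) X * \<alpha> (i, j) Y) * q i j)" if "i < r" for i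
    proof -
      have "h \<circ>\<^sub>\<partial> (l i ^ d) = (\<Sum>j<N. Poly_Mapping.single 0 (mv_eval (\<lambda>k. \<omega> ^ j * p i k) h) * q i j)"
        unfolding \<omega>_def q_def using N
        by (intro diff_act_power_eq_sum_eval deg)
          (simp_all del: One_nat_def add: p_def partial_homogeneous_1[OF l[OF that]])
      then show ?thesis by (simp add: h_def mv_eval_mult \<alpha>_def)
    qed
    \<comment> \<open>The instance with constant 0 gives
      \<open>h \<circ>\<^sub>\<partial> 0 = 0\<close>, the case of the empty sum.\<close>
    have act_sum: "h \<circ>\<^sub>\<partial> (\<Sum>i<r. F i) = (\<Sum>i<r. h \<circ>\<^sub>\<partial> F i)" for F :: "nat \<Rightarrow> 'n mvpoly"
      using diff_act_const_mult_right[of h 0 0] by (induction r) (simp_all add: diff_act_add_right)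
    have "h \<circ>\<^sub>\<partial> f = (\<Sum>i<r. Poly_Mapping.single 0 (c i) * (h \<circ>\<^sub>\<partial> (l i ^ d)))"
      by (subst sum) (simp add: act_sum diff_act_const_mult_right)
    also have "\<dots> = (\<Sum>i<r. \<Sum>j<N. Poly_Mapping.single 0 (\<alpha> (i, j) X * \<alpha> (i, j) Y) *
        (Poly_Mapping.single 0 (c i) * q i j))"
      by (intro sum.cong refl) (simp add: act sum_distrib_left mult_ac)
    also have "\<dots> = (\<Sum>t\<in>?I. Poly_Mapping.single 0 (\<alpha> t X * \<alpha> t Y) *
        (Poly_Mapping.single 0 (c (fst t)) * q (fst t) (snd t)))"
      by (simp add: sum.cartesian_product case_prod_unfold)
    finally have "g (h \<circ>\<^sub>\<partial> f) = (\<Sum>t\<in>?I. Poly_Mapping.single 0 (\<alpha> t X * \<alpha> t Y) *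
        g (Poly_Mapping.single 0 (c (fst t)) * q (fst t) (snd t)))"
      by (simp only: g.sum g.scale)
    then have "apolar_class f (g (h \<circ>\<^sub>\<partial> f)) = (\<Oplus>\<^bsub>?A\<^esub>t\<in>?I. (\<alpha> t X * \<alpha> t Y) \<odot>\<^bsub>?A\<^esub> w t)"
      by (simp add: apolar_class_sum apolar_class_const_mult w_def case_prod_unfold)
    \<comment> \<open>The polynomial \<open>g (h \<circ>\<^sub>\<partial> f)\<close> may differ from
      \<open>h\<close>, but both act alike on \<open>f\<close>, and the class records nothing
      else.\<close>
    moreover have "apolar_class f (g (h \<circ>\<^sub>\<partial> f)) = apolar_class f h"
      by (rule apolar_class_eqI) (rule inv)
    ultimately show ?thesis using XY by (simp add: h_def apolar_class_mult s)
  qed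
  then have "tensor_rank ?A (structure_tensor ?A B) \<le> enat (card ?I)"
    using B by (intro structure_tensor_rank_le[OF A.module_axioms])
      (auto simp: w_def apolar_class_closed)
  then show ?thesis
    by (simp add: algebra_rank_def B_def mult.commute)
qed

theorem theorem3:
  fixes f :: "'n::finite mvpoly" and d :: nat
  assumes "homogeneous d f"
  shows "algebra_rank (apolar_algebra f) \<le> enat (3 * d + 1) * waring_rank d f"
proof -
  let ?R = "{enat r | r. \<exists>(c :: nat \<Rightarrow> complex) (l :: nat \<Rightarrow> 'n mvpoly).
     (\<forall>i<r. homogeneous 1 (l i)) \<and> f = (\<Sum>i<r. Poly_Mapping.single 0 (c i) * l i ^ d)}"
  show ?thesis
  \<comment> \<open>Without a decomposition the infimum is \<infinity>, and so is the right-hand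
    side because \<open>3 * d + 1\<close> is positive.\<close>
  proof (cases "?R = {}")
    case True
    then have "waring_rank d f = \<infinity>" unfolding waring_rank_def by (simp only: Inf_enat_def) simp
    then show ?thesis by simp
  next
    case False
    \<comment> \<open>The extended naturals are well-ordered, so the least number of summands is
      attained by an actual decomposition.\<close>
    then have "Inf ?R \<in> ?R"
      unfolding Inf_enat_def by (metis (mono_tags, lifting) LeastI ex_in_conv)
    then obtain r c l where "waring_rank d f = enat r" "\<forall>i<r. homogeneous 1 (l i)"
      "f = (\<Sum>i<r. Poly_Mapping.single 0 (c i) * l i ^ d)"
      unfolding waring_rank_def by blast
    \<comment> \<open>The number \<open>3 * d + 1\<close> of roots of unity is admissible, since it
      exceeds \<open>2 * d\<close> for every \<open>d\<close>, including 0.\<close>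
    then show ?thesis
      using apolar_algebra_rank_le[OF assms, of r l c "3 * d + 1"] by simp
  qed
qed

end
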